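(* Let $\Omega \subset \mathbb{R}^n$ be a compact region. Then the total variation profile $t \mapsto I_\Omega^{\mathrm{TV}}(t)$ is a convex function of $t$ on $[0,\mathrm{vol}(\Omega)]$ (with values in $[0,+\infty]$).
   Context: $\mathrm{vol}$ denotes Lebesgue measure on $\mathbb{R}^n$ and $\mathbb{1}_\Omega$ the indicator function of $\Omega$. For $f \in L^1(\mathbb{R}^n)$, the total variation is $$\mathrm{TV}[f] := \sup\left\{ \int_{\mathbb{R}^n} f(x)\, \nabla\cdot\phi(x)\, dx : \phi \in C_c^1(\mathbb{R}^n \to \mathbb{R}^n),\ \|\phi\|_\infty \le 1\right\} \in [0,+\infty],$$ where $\|\phi\|_\infty$ is the supremum over $x$ of the Euclidean norm of $\phi(x)$. The total variation (TV) profile of $\Omega$ is, for $t \in [0,\mathrm{vol}(\Omega)]$, $$I_\Omega^{\mathrm{TV}}(t) := \min\left\{ \mathrm{TV}[f] : f \in L^1(\mathbb{R}^n),\ \int_{\mathbb{R}^n} f(x)\,dx = t,\ 0 \le f \le \mathbb{1}_\Omega \text{ a.e.}\right\},$$ with value $+\infty$ if every admissible $f$ has infinite total variation. *)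

theory Defs
  imports "HOL-Analysis.Analysis"
begin

definition divergence :: "(real ^ 'n \<Rightarrow> real ^ 'n) \<Rightarrow> real ^ 'n \<Rightarrow> real" where
  "divergence \<phi> x = (\<Sum>i\<in>UNIV. jacobian \<phi> (at x) $ i $ i)"

definition C1_compact_support :: "(real ^ 'n \<Rightarrow> real ^ 'n) \<Rightarrow> bool" where
  "C1_compact_support \<phi> \<longleftrightarrow>
     (\<forall>x. \<phi> differentiable (at x)) \<and>
     continuous_on UNIV (\<lambda>x. jacobian \<phi> (at x)) \<and>
     compact (closure {x. \<phi> x \<noteq> 0})"

definition total_variation :: "(real ^ 'n \<Rightarrow> real) \<Rightarrow> ereal" where
  "total_variation f =
     (SUP \<phi> \<in> {\<phi>. C1_compact_support \<phi> \<and> (\<forall>x. norm (\<phi> x) \<le> 1)}.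
        ereal (\<integral>x. f x * divergence \<phi> x \<partial>lebesgue))"

definition admissible :: "(real ^ 'n) set \<Rightarrow> real \<Rightarrow> (real ^ 'n \<Rightarrow> real) set" where
  "admissible \<Omega> t =
     {f. integrable lebesgue f \<and> (\<integral>x. f x \<partial>lebesgue) = t \<and>
         (AE x in lebesgue. 0 \<le> f x \<and> f x \<le> indicat_real \<Omega> x)}"

text \<open>The operator LEAST denotes the attained minimum, not merely the infimum. If every
  admissible function has infinite total variation, this minimum is infinity. The definition is
  meaningful only for t between 0 and the volume of the set: otherwise no function is
  admissible and the value is unspecified.\<close>

definition TV_profile :: "(real ^ 'n) set \<Rightarrow> real \<Rightarrow> ereal" where
  "TV_profile \<Omega> t = (LEAST c. c \<in> total_variation ` admissible \<Omega> t)"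

text \<open>The analogue of the library's \<^const>\<open>convex_on\<close>, which only covers real-valued functions.
  With values in [0, infinity] the right-hand side never has the form infinity minus infinity,
  and since 0 times infinity is 0 in \<^typ>\<open>ereal\<close>, the endpoint cases u = 0 and v = 0 are
  trivially true.\<close>

definition ereal_convex_on :: "'a::real_vector set \<Rightarrow> ('a \<Rightarrow> ereal) \<Rightarrow> bool" where
  "ereal_convex_on S f \<longleftrightarrow>
     convex S \<and>
     (\<forall>x\<in>S. \<forall>y\<in>S. \<forall>u\<ge>0. \<forall>v\<ge>0. u + v = 1 \<longrightarrow>
        f (u *\<^sub>R x + v *\<^sub>R y) \<le> ereal u * f x + ereal v * f y)"

end

theory Submission
  imports Defs
begin

text \<open>
  The profile is defined by a minimum, so the theorem has two parts: the minimum is attained, and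
  the attained minimum depends convexly on the mass.

  Total variation is a supremum of linear functionals, hence convex. If \<open>f\<close> and \<open>g\<close> are
  minimizers for the masses \<open>s\<close> and \<open>t\<close>, then \<open>u f + v g\<close> is admissible for \<open>u s + v t\<close>, and its
  total variation is at most the convex combination of the two minima. This is the second part.

  For the first part it would be usual to invoke the compactness of bounded sets of functions of
  bounded variation, or weak compactness. Convexity allows an elementary substitute. Let \<open>m\<close> be
  the infimum, assumed finite. The admissible functions of total variation at most \<open>m + 1/(k+1)\<close>
  form a decreasing sequence of nonempty convex sets \<open>S\<^sub>k\<close>. Choose in every \<open>S\<^sub>k\<close> an element whose
  \<open>L\<^sup>2\<close> norm is almost the least possible in \<open>S\<^sub>k\<close>. By the parallelogram law these elements form a
  Cauchy sequence in \<open>L\<^sup>2\<close>, hence in \<open>L\<^sup>1\<close> because they vanish outside a set of finite measure, and a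
  subsequence converges almost everywhere (\<open>nested_midpoint_convex_AE_limit\<close>). Dominated
  convergence passes mass, constraint, and each integral against a divergence to the limit, which
  is therefore a minimizer (\<open>total_variation_attains_min\<close>).
\<close>

section \<open>Limits from nested convex sets\<close>

lemma integrable_AE_abs_le_indicator:
  assumes "A \<in> fmeasurable M" "f \<in> borel_measurable M" "AE x in M. \<bar>f x\<bar> \<le> indicat_real A x"
  shows "integrable M f"
proof (rule Bochner_Integration.integrable_bound)
  show "integrable M (indicat_real A)"
    using assms(1) by (auto simp: fmeasurable_def intro: integrable_real_indicator)
qed (use assms in auto)

text \<open>By the parallelogram law, two functions are close in \<open>L\<^sup>2\<close> if their norms are close to the
  infimum over the set, because the norm of their midpoint is not below it. Hence near-minimal
  elements of \<open>S k\<close> form a Cauchy sequence: the infima increase with \<open>k\<close> and are bounded.\<close>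

lemma nested_midpoint_convex_AE_limit:
  fixes S :: "nat \<Rightarrow> ('a \<Rightarrow> real) set"
  assumes A: "A \<in> fmeasurable M"
    and meas: "\<And>k f. f \<in> S k \<Longrightarrow> f \<in> borel_measurable M"
    and bound: "\<And>k f. f \<in> S k \<Longrightarrow> AE x in M. \<bar>f x\<bar> \<le> indicat_real A x"
    and nonempty: "\<And>k. S k \<noteq> {}"
    and nested: "decseq S"
    and midpoint: "\<And>k f g. f \<in> S k \<Longrightarrow> g \<in> S k \<Longrightarrow> (\<lambda>x. (f x + g x) / 2) \<in> S k"
  obtains g f where "\<And>k. g k \<in> S k" "f \<in> borel_measurable M" "AE x in M. (\<lambda>k. g k x) \<longlonglongrightarrow> f x"
proof -
  define N where "N f = (\<integral>x. (f x)\<^sup>2 \<partial>M)" for f :: "'a \<Rightarrow> real"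
  define d where "d k = (INF f\<in>S k. N f)" for k
  have intA: "integrable M (indicat_real A)"
    using A by (auto simp: fmeasurable_def intro: integrable_real_indicator)
  have int: "integrable M f" if "f \<in> S k" for f k
    using integrable_AE_abs_le_indicator[OF A meas[OF that] bound[OF that]] .
  have sq_bound: "AE x in M. (f x)\<^sup>2 \<le> indicat_real A x" if "f \<in> S k" for f k
    using bound[OF that]
    by eventually_elim (auto split: split_indicator_asm simp: abs_square_le_1)
  have int_sq: "integrable M (\<lambda>x. (f x)\<^sup>2)" if "f \<in> S k" for f k
    using meas[OF that] sq_bound[OF that] by (intro integrable_AE_abs_le_indicator[OF A]) auto
  have N_nonneg: "0 \<le> N f" for f
    unfolding N_def by simp
  have N_le: "N f \<le> measure M A" if "f \<in> S k" for f k
  proof -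
    have "N f \<le> integral\<^sup>L M (indicat_real A)"
      unfolding N_def using int_sq[OF that] intA sq_bound[OF that] by (rule integral_mono_AE)
    then show ?thesis
      using A by (simp add: Int_absorb2 sets.sets_into_space fmeasurableD)
  qed
  have bdd: "bdd_below (N ` S k)" for k
    by (rule bdd_belowI2[of _ 0]) (rule N_nonneg)
  have d_le: "d k \<le> N f" if "f \<in> S k" for f k
    unfolding d_def using bdd that by (rule cINF_lower)
  have "incseq d"
    unfolding incseq_def d_def
    using nonempty bdd nested
    by (intro allI impI cINF_superset_mono) (simp_all add: decseq_def)
  moreover have "\<forall>k. d k \<le> measure M A"
    using nonempty d_le N_le by (meson all_not_in_conv order_trans)
  ultimately obtain D where D: "d \<longlonglongrightarrow> D" "\<forall>k. d k \<le> D"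
    by (rule incseq_convergent)
  have "\<exists>f\<in>S k. N f < d k + 1 / real (Suc k)" for k
  proof -
    have "Inf (N ` S k) < d k + 1 / real (Suc k)"
      unfolding d_def by simp
    from cInf_lessD[OF _ this] nonempty show ?thesis by auto
  qed
  then obtain g where g: "\<And>k. g k \<in> S k" and g_less: "\<And>k. N (g k) < d k + 1 / real (Suc k)"
    by metis
  have parallelogram: "(\<integral>x. (f x - h x)\<^sup>2 \<partial>M) \<le> 2 * N f + 2 * N h - 4 * d k"
    if "f \<in> S k" "h \<in> S k" for f h k
  proof -
    note mid = midpoint[OF that]
    have "(\<integral>x. (f x - h x)\<^sup>2 \<partial>M) =
        (\<integral>x. 2 * (f x)\<^sup>2 + 2 * (h x)\<^sup>2 - 4 * ((f x + h x) / 2)\<^sup>2 \<partial>M)"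
      by (rule Bochner_Integration.integral_cong) (auto simp: power2_eq_square field_simps)
    also have "\<dots> = 2 * N f + 2 * N h - 4 * N (\<lambda>x. (f x + h x) / 2)"
      unfolding N_def using int_sq[OF that(1)] int_sq[OF that(2)] int_sq[OF mid]
      by (simp del: power_divide)
    finally show ?thesis
      using d_le[OF mid] by linarith
  qed
  \<comment> \<open>A weighted arithmetic-geometric mean inequality, in place of Cauchy-Schwarz, bounds the
    \<open>L\<^sup>1\<close> distance by the \<open>L\<^sup>2\<close> distance on a set of finite measure.\<close>
  have L1_le: "(\<integral>x. norm (f x - h x) \<partial>M) \<le> (c * (\<integral>x. (f x - h x)\<^sup>2 \<partial>M) + measure M A / c) / 2"
    if fh: "f \<in> S k" "h \<in> S k" and c: "c > 0" for f h k c
  proof -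
    have int_sq_diff: "integrable M (\<lambda>x. (f x - h x)\<^sup>2)"
    proof -
      have "integrable M (\<lambda>x. 2 * (f x)\<^sup>2 + 2 * (h x)\<^sup>2 - 4 * ((f x + h x) / 2)\<^sup>2)"
        using int_sq[OF fh(1)] int_sq[OF fh(2)] int_sq[OF midpoint[OF fh]]
        by (intro Bochner_Integration.integrable_add Bochner_Integration.integrable_diff
            integrable_mult_right) auto
      moreover have "(\<lambda>x. 2 * (f x)\<^sup>2 + 2 * (h x)\<^sup>2 - 4 * ((f x + h x) / 2)\<^sup>2) =
          (\<lambda>x. (f x - h x)\<^sup>2)"
        by (auto simp: power2_eq_square field_simps)
      ultimately show ?thesis by simp
    qed
    have amgm: "\<bar>y\<bar> \<le> (c * y\<^sup>2 + 1 / c) / 2" for y :: real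
    proof -
      have square: "(c * z - 1)\<^sup>2 / c = c * z\<^sup>2 + 1 / c - 2 * z" for z :: real
        using c by (simp add: field_simps power2_eq_square)
      have "0 \<le> (c * \<bar>y\<bar> - 1)\<^sup>2 / c"
        using c by simp
      also have "\<dots> = c * y\<^sup>2 + 1 / c - 2 * \<bar>y\<bar>"
        unfolding square by simp
      finally show ?thesis by simp
    qed
    have "(\<integral>x. norm (f x - h x) \<partial>M) \<le>
        (\<integral>x. (c * (f x - h x)\<^sup>2 + indicat_real A x / c) / 2 \<partial>M)"
    proof (rule integral_mono_AE)
      show "integrable M (\<lambda>x. norm (f x - h x))"
        using int[OF fh(1)] int[OF fh(2)] by simp
      show "integrable M (\<lambda>x. (c * (f x - h x)\<^sup>2 + indicat_real A x / c) / 2)"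
        using int_sq_diff intA by simp
      show "AE x in M. norm (f x - h x) \<le> (c * (f x - h x)\<^sup>2 + indicat_real A x / c) / 2"
        using bound[OF fh(1)] bound[OF fh(2)]
      proof eventually_elim
        case (elim x)
        then show ?case
          using amgm[of "f x - h x"] by (cases "x \<in> A") auto
      qed
    qed
    also have "\<dots> = (c * (\<integral>x. (f x - h x)\<^sup>2 \<partial>M) + measure M A / c) / 2"
      using int_sq_diff intA A by (simp add: Int_absorb2 sets.sets_into_space fmeasurableD)
    finally show ?thesis .
  qed
  have Cauchy_L1: "\<exists>n. \<forall>i\<ge>n. \<forall>j\<ge>n. (\<integral>x. norm (g i x - g j x) \<partial>M) < e" if e: "e > 0" for e
  proof -
    \<comment> \<open>With this \<open>c\<close> the term \<open>measure M A / c\<close> is below \<open>e\<close>, whatever the \<open>L\<^sup>2\<close> distance is.\<close>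
    define c where "c = (measure M A + 1) / e"
    have pos: "measure M A + 1 > 0"
      by (simp add: add_nonneg_pos)
    then have c: "c > 0" unfolding c_def using e by simp
    have A_less: "measure M A / c < e"
      unfolding c_def using e pos by (simp add: field_simps)
    have "\<forall>\<^sub>F n in sequentially. D - e / (8 * c) < d n"
      using D(1) e c by (intro order_tendstoD(1)) auto
    moreover have "\<forall>\<^sub>F n in sequentially. 1 / real (Suc n) < e / (8 * c)"
      using LIMSEQ_inverse_real_of_nat e c
      by (intro order_tendstoD(2)[of _ 0]) (auto simp: inverse_eq_divide)
    ultimately have "\<forall>\<^sub>F n in sequentially.
        D - e / (8 * c) < d n \<and> 1 / real (Suc n) < e / (8 * c)"
      by (rule eventually_conj)
    then obtain n where n: "D - e / (8 * c) < d n" "1 / real (Suc n) < e / (8 * c)"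
      unfolding eventually_sequentially by blast
    have "(\<integral>x. norm (g i x - g j x) \<partial>M) < e" if ij: "i \<ge> n" "j \<ge> n" for i j
    proof -
      have gn: "g l \<in> S n" if "l \<ge> n" for l
        using g[of l] nested that by (auto simp: decseq_def)
      have N_less: "N (g l) < D + e / (8 * c)" if "l \<ge> n" for l
      proof -
        have "1 / real (Suc l) \<le> 1 / real (Suc n)"
          using that by (simp add: frac_le)
        then show ?thesis
          using g_less[of l] D(2)[rule_format, of l] n(2) by linarith
      qed
      have "(\<integral>x. (g i x - g j x)\<^sup>2 \<partial>M) < 8 * (e / (8 * c))"
        using parallelogram[OF gn[OF ij(1)] gn[OF ij(2)]] N_less[OF ij(1)] N_less[OF ij(2)] n(1)
        by linarith
      then have "c * (\<integral>x. (g i x - g j x)\<^sup>2 \<partial>M) < e"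
        using c by (simp add: field_simps)
      from add_strict_mono[OF this A_less]
      have "(c * (\<integral>x. (g i x - g j x)\<^sup>2 \<partial>M) + measure M A / c) / 2 < e"
        by simp
      with L1_le[OF gn[OF ij(1)] gn[OF ij(2)] c] show ?thesis
        by (rule order.strict_trans1)
    qed
    then show ?thesis by blast
  qed
  obtain r where r: "strict_mono r" and r_Cauchy: "AE x in M. Cauchy (\<lambda>i. g (r i) x)"
    using cauchy_L1_AE_cauchy_subseq[of M g] int[OF g] Cauchy_L1 by blast
  show ?thesis
  proof (rule that[of "\<lambda>k. g (r k)" "\<lambda>x. lim (\<lambda>k. g (r k) x)"])
    show "g (r k) \<in> S k" for k
      using g[of "r k"] nested strict_mono_imp_increasing[OF r, of k] by (auto simp: decseq_def)
    show "(\<lambda>x. lim (\<lambda>k. g (r k) x)) \<in> borel_measurable M"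
      using meas[OF g] by (intro borel_measurable_lim_metric) auto
    show "AE x in M. (\<lambda>k. g (r k) x) \<longlonglongrightarrow> lim (\<lambda>k. g (r k) x)"
      using r_Cauchy by eventually_elim (simp add: Cauchy_convergent_iff convergent_LIMSEQ_iff)
  qed
qed

section \<open>Divergences of test fields\<close>

lemma continuous_on_divergence:
  assumes "C1_compact_support \<phi>"
  shows "continuous_on UNIV (divergence \<phi>)"
proof -
  have "continuous_on UNIV (\<lambda>x. jacobian \<phi> (at x))"
    using assms by (simp add: C1_compact_support_def)
  then show ?thesis
    unfolding divergence_def by (intro continuous_intros)
qed

lemma borel_measurable_divergence:
  assumes "C1_compact_support \<phi>"
  shows "divergence \<phi> \<in> borel_measurable lebesgue"
  using borel_measurable_continuous_onI[OF continuous_on_divergence[OF assms]]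
  by (intro measurable_completion) simp

lemma divergence_eq_0_outside_support:
  assumes "C1_compact_support \<phi>" "x \<notin> closure {x. \<phi> x \<noteq> 0}"
  shows "divergence \<phi> x = 0"
proof -
  have "frechet_derivative \<phi> (at x) = frechet_derivative (\<lambda>_. 0) (at x)"
  proof (rule frechet_derivative_transform_within_open)
    show "\<phi> differentiable at x"
      using assms(1) by (simp add: C1_compact_support_def)
    show "open (- closure {x. \<phi> x \<noteq> 0})" by auto
    show "\<phi> y = 0" if "y \<in> - closure {x. \<phi> x \<noteq> 0}" for y
      using that closure_subset[of "{x. \<phi> x \<noteq> 0}"] by auto
  qed (use assms(2) in auto)
  then show ?thesis
    by (simp add: divergence_def jacobian_def matrix_def)
qed

lemma divergence_bounded:
  assumes "C1_compact_support \<phi>"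
  obtains B where "\<And>x. \<bar>divergence \<phi> x\<bar> \<le> B"
proof -
  let ?K = "closure {x. \<phi> x \<noteq> 0}"
  have "compact (divergence \<phi> ` ?K)"
    using assms continuous_on_subset[OF continuous_on_divergence[OF assms]]
    by (intro compact_continuous_image) (auto simp: C1_compact_support_def)
  then obtain B where B: "\<And>x. x \<in> ?K \<Longrightarrow> \<bar>divergence \<phi> x\<bar> \<le> B"
    by (metis bounded_iff compact_imp_bounded image_eqI real_norm_def)
  have "\<bar>divergence \<phi> x\<bar> \<le> max B 0" for x
    using B[of x] divergence_eq_0_outside_support[OF assms, of x] by (cases "x \<in> ?K") auto
  then show ?thesis by (rule that)
qed

lemma integrable_mult_divergence:
  assumes "C1_compact_support \<phi>" "integrable lebesgue f"
  shows "integrable lebesgue (\<lambda>x. f x * divergence \<phi> x)"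
proof -
  obtain B where B: "\<And>x. \<bar>divergence \<phi> x\<bar> \<le> B"
    using divergence_bounded[OF assms(1)] by blast
  show ?thesis
  proof (rule Bochner_Integration.integrable_bound)
    show "integrable lebesgue (\<lambda>x. B * f x)"
      using assms(2) by simp
    show "(\<lambda>x. f x * divergence \<phi> x) \<in> borel_measurable lebesgue"
      using assms borel_measurable_divergence by (intro borel_measurable_times) auto
    have "\<bar>f x * divergence \<phi> x\<bar> \<le> \<bar>B * f x\<bar>" for x
      using mult_left_mono[OF order_trans[OF B abs_ge_self], of "\<bar>f x\<bar>" x]
      by (simp add: abs_mult mult.commute)
    then show "AE x in lebesgue. norm (f x * divergence \<phi> x) \<le> norm (B * f x)" by simp
  qed
qed

section \<open>Total variation\<close>

lemma integral_le_total_variation: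
  assumes "C1_compact_support \<phi>" "\<And>x. norm (\<phi> x) \<le> 1"
  shows "ereal (\<integral>x. f x * divergence \<phi> x \<partial>lebesgue) \<le> total_variation f"
  unfolding total_variation_def using assms by (intro SUP_upper) auto

lemma total_variation_nonneg: "0 \<le> total_variation f"
proof -
  let ?z = "\<lambda>_ :: real ^ 'a. 0 :: real ^ 'a"
  have jac: "jacobian ?z (at x) = 0" for x
    by (simp add: jacobian_def matrix_def vec_eq_iff)
  have "C1_compact_support ?z"
    by (simp add: C1_compact_support_def jac)
  then have "ereal (\<integral>x. f x * divergence ?z x \<partial>lebesgue) \<le> total_variation f"
    by (rule integral_le_total_variation) simp
  then show ?thesis
    by (simp add: divergence_def jac zero_ereal_def)
qed

lemma total_variation_convex_combination:
  assumes "integrable lebesgue f" "integrable lebesgue g" "u \<ge> 0" "v \<ge> 0"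
  shows "total_variation (\<lambda>x. u * f x + v * g x) \<le>
    ereal u * total_variation f + ereal v * total_variation g"
  unfolding total_variation_def[of "\<lambda>x. u * f x + v * g x"]
proof (rule SUP_least, clarify)
  fix \<phi> :: "real ^ 'a \<Rightarrow> real ^ 'a"
  assume \<phi>: "C1_compact_support \<phi>" "\<forall>x. norm (\<phi> x) \<le> 1"
  define F where "F = (\<integral>x. f x * divergence \<phi> x \<partial>lebesgue)"
  define G where "G = (\<integral>x. g x * divergence \<phi> x \<partial>lebesgue)"
  have "(\<integral>x. (u * f x + v * g x) * divergence \<phi> x \<partial>lebesgue) =
      (\<integral>x. u * (f x * divergence \<phi> x) + v * (g x * divergence \<phi> x) \<partial>lebesgue)"
    by (simp add: algebra_simps)
  also have "\<dots> = u * F + v * G"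
    unfolding F_def G_def using integrable_mult_divergence[OF \<phi>(1)] assms(1,2) by simp
  finally have "ereal (\<integral>x. (u * f x + v * g x) * divergence \<phi> x \<partial>lebesgue) =
      ereal u * ereal F + ereal v * ereal G"
    by simp
  also have "\<dots> \<le> ereal u * total_variation f + ereal v * total_variation g"
    unfolding F_def G_def using \<phi> assms(3,4)
    by (intro add_mono ereal_mult_left_mono integral_le_total_variation) auto
  finally show "ereal (\<integral>x. (u * f x + v * g x) * divergence \<phi> x \<partial>lebesgue) \<le>
      ereal u * total_variation f + ereal v * total_variation g" .
qed

text \<open>Lower semicontinuity along dominated almost everywhere convergence: each functional in the
  supremum is continuous for it, since divergences of test fields are bounded.\<close>

lemma total_variation_le_dominated_limit:
  assumes "f \<in> borel_measurable lebesgue" "\<And>k. g k \<in> borel_measurable lebesgue"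
    and lim: "AE x in lebesgue. (\<lambda>k. g k x) \<longlonglongrightarrow> f x"
    and w: "integrable lebesgue w" "\<And>k. AE x in lebesgue. \<bar>g k x\<bar> \<le> w x"
    and c: "\<And>k. total_variation (g k) \<le> ereal (c k)" "c \<longlonglongrightarrow> m"
  shows "total_variation f \<le> ereal m"
  unfolding total_variation_def
proof (rule SUP_least, clarify)
  fix \<phi> :: "real ^ 'a \<Rightarrow> real ^ 'a"
  assume \<phi>: "C1_compact_support \<phi>" "\<forall>x. norm (\<phi> x) \<le> 1"
  obtain B where B: "\<And>x. \<bar>divergence \<phi> x\<bar> \<le> B"
    using divergence_bounded[OF \<phi>(1)] by blast
  have "(\<lambda>k. \<integral>x. g k x * divergence \<phi> x \<partial>lebesgue) \<longlonglongrightarrow> (\<integral>x. f x * divergence \<phi> x \<partial>lebesgue)"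
  proof (rule integral_dominated_convergence)
    show "integrable lebesgue (\<lambda>x. w x * B)"
      using w(1) by simp
    show "AE x in lebesgue. (\<lambda>k. g k x * divergence \<phi> x) \<longlonglongrightarrow> f x * divergence \<phi> x"
      using lim by eventually_elim (intro tendsto_intros)
    show "AE x in lebesgue. norm (g k x * divergence \<phi> x) \<le> w x * B" for k
      using w(2)[of k]
    proof eventually_elim
      case (elim x)
      then have "0 \<le> w x" by linarith
      with elim B[of x] show ?case
        by (simp add: abs_mult mult_mono)
    qed
  qed (use assms(1,2) borel_measurable_divergence[OF \<phi>(1)] in auto)
  moreover have "(\<integral>x. g k x * divergence \<phi> x \<partial>lebesgue) \<le> c k" for k
    using order_trans[OF integral_le_total_variation[OF \<phi>(1), of "g k"] c(1)[of k]] \<phi>(2) by simp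
  ultimately have "(\<integral>x. f x * divergence \<phi> x \<partial>lebesgue) \<le> m"
    using c(2) by (intro LIMSEQ_le[of _ _ c]) auto
  then show "ereal (\<integral>x. f x * divergence \<phi> x \<partial>lebesgue) \<le> ereal m" by simp
qed

section \<open>Admissible functions and existence of minimizers\<close>

lemma admissible_convex_combination:
  assumes f: "f \<in> admissible \<Omega> s" and g: "g \<in> admissible \<Omega> t"
    and uv: "u \<ge> 0" "v \<ge> 0" "u + v = 1"
  shows "(\<lambda>x. u * f x + v * g x) \<in> admissible \<Omega> (u * s + v * t)"
proof -
  have "AE x in lebesgue. 0 \<le> f x \<and> f x \<le> indicat_real \<Omega> x"
    and "AE x in lebesgue. 0 \<le> g x \<and> g x \<le> indicat_real \<Omega> x"
    using f g by (auto simp: admissible_def)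
  then have "AE x in lebesgue. 0 \<le> u * f x + v * g x \<and> u * f x + v * g x \<le> indicat_real \<Omega> x"
    by eventually_elim (use uv in \<open>simp add: convex_bound_le\<close>)
  with f g show ?thesis
    by (auto simp: admissible_def)
qed

text \<open>Spreading the mass uniformly over the set is always possible. For a null set the only mass is
  zero, and the quotient below is then zero as well.\<close>

lemma admissible_nonempty:
  assumes \<Omega>: "\<Omega> \<in> lmeasurable" and t: "t \<in> {0..measure lebesgue \<Omega>}"
  shows "admissible \<Omega> t \<noteq> {}"
proof -
  let ?a = "t / measure lebesgue \<Omega>"
  have a: "0 \<le> ?a" "?a \<le> 1"
    using t by (auto simp: divide_le_eq_1)
  have "integrable lebesgue (indicat_real \<Omega>)"
    using \<Omega> by (auto simp: fmeasurable_def intro: integrable_real_indicator)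
  then have "(\<lambda>x. ?a * indicat_real \<Omega> x) \<in> admissible \<Omega> t"
    using a t by (auto simp: admissible_def split: split_indicator)
  then show ?thesis by blast
qed

lemma admissible_AE_limit:
  assumes \<Omega>: "\<Omega> \<in> lmeasurable" and g: "\<And>k. g k \<in> admissible \<Omega> t"
    and f: "f \<in> borel_measurable lebesgue"
    and lim: "AE x in lebesgue. (\<lambda>k. g k x) \<longlonglongrightarrow> f x"
  shows "f \<in> admissible \<Omega> t"
proof -
  have int: "integrable lebesgue (indicat_real \<Omega>)"
    using \<Omega> by (auto simp: fmeasurable_def intro: integrable_real_indicator)
  have bound: "AE x in lebesgue. \<forall>k. 0 \<le> g k x \<and> g k x \<le> indicat_real \<Omega> x"
    using g by (auto simp: admissible_def AE_all_countable)
  have abs_bound: "AE x in lebesgue. norm (g k x) \<le> indicat_real \<Omega> x" for k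
    using bound by eventually_elim (auto simp: abs_le_iff)
  have g_meas: "g k \<in> borel_measurable lebesgue" for k
    using g[of k] by (auto simp: admissible_def)
  have "integrable lebesgue f"
    by (rule integrable_dominated_convergence[OF f g_meas int lim abs_bound])
  moreover have "(\<integral>x. f x \<partial>lebesgue) = t"
  proof (rule LIMSEQ_unique)
    show "(\<lambda>k. integral\<^sup>L lebesgue (g k)) \<longlonglongrightarrow> (\<integral>x. f x \<partial>lebesgue)"
      by (rule integral_dominated_convergence[OF f g_meas int lim abs_bound])
    show "(\<lambda>k. integral\<^sup>L lebesgue (g k)) \<longlonglongrightarrow> t"
      using g by (simp add: admissible_def)
  qed
  moreover have "AE x in lebesgue. 0 \<le> f x \<and> f x \<le> indicat_real \<Omega> x"
    using bound lim
  proof eventually_elim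
    case (elim x)
    then show ?case
      using LIMSEQ_le_const[of "\<lambda>k. g k x"] LIMSEQ_le_const2[of "\<lambda>k. g k x"] by blast
  qed
  ultimately show ?thesis
    by (simp add: admissible_def)
qed

lemma total_variation_attains_min:
  assumes \<Omega>: "\<Omega> \<in> lmeasurable" and ne: "admissible \<Omega> t \<noteq> {}"
  shows "\<exists>f\<in>admissible \<Omega> t. \<forall>h\<in>admissible \<Omega> t. total_variation f \<le> total_variation h"
proof -
  define m where "m = (INF f\<in>admissible \<Omega> t. total_variation f)"
  have m_le: "m \<le> total_variation f" if "f \<in> admissible \<Omega> t" for f
    unfolding m_def using that by (rule INF_lower)
  have "m \<ge> 0"
    unfolding m_def by (intro INF_greatest total_variation_nonneg)
  show ?thesis
  proof (cases m)
    case PInf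
    then show ?thesis
      using m_le ne by auto
  next
    case MInf
    with \<open>m \<ge> 0\<close> show ?thesis by simp
  next
    case (real r)
    define c where "c k = r + 1 / real (Suc k)" for k
    define S where "S k = {f \<in> admissible \<Omega> t. total_variation f \<le> ereal (c k)}" for k
    have abs_bound: "AE x in lebesgue. \<bar>f x\<bar> \<le> indicat_real \<Omega> x" if "f \<in> admissible \<Omega> t" for f
    proof -
      have "AE x in lebesgue. 0 \<le> f x \<and> f x \<le> indicat_real \<Omega> x"
        using that by (simp add: admissible_def)
      then show ?thesis by eventually_elim auto
    qed
    have "\<exists>g f. (\<forall>k. g k \<in> S k) \<and> f \<in> borel_measurable lebesgue \<and>
        (AE x in lebesgue. (\<lambda>k. g k x) \<longlonglongrightarrow> f x)"
    proof (rule nested_midpoint_convex_AE_limit[of \<Omega> lebesgue S])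
      show "\<Omega> \<in> lmeasurable" by fact
      show "f \<in> borel_measurable lebesgue" if "f \<in> S k" for f k
        using that by (auto simp: S_def admissible_def)
      show "AE x in lebesgue. \<bar>f x\<bar> \<le> indicat_real \<Omega> x" if "f \<in> S k" for f k
        using that abs_bound by (simp add: S_def)
      show "S k \<noteq> {}" for k
      proof -
        have "m < ereal (c k)"
          by (simp add: real c_def)
        then show ?thesis
          unfolding m_def S_def INF_less_iff by (auto intro: less_imp_le)
      qed
      have c_mono: "c l \<le> c k" if "k \<le> l" for k l
        using that by (simp add: c_def frac_le)
      show "decseq S"
        unfolding decseq_def S_def using c_mono order_trans by fastforce
      show "(\<lambda>x. (f x + h x) / 2) \<in> S k" if fh: "f \<in> S k" "h \<in> S k" for f h k
      proof -
        have mid: "(\<lambda>x. (f x + h x) / 2) = (\<lambda>x. (1 / 2) * f x + (1 / 2) * h x)"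
          by (auto simp: field_simps)
        have "total_variation (\<lambda>x. (f x + h x) / 2) \<le>
            ereal (1 / 2) * total_variation f + ereal (1 / 2) * total_variation h"
          unfolding mid using fh
          by (intro total_variation_convex_combination) (auto simp: S_def admissible_def)
        also have "\<dots> \<le> ereal (1 / 2) * ereal (c k) + ereal (1 / 2) * ereal (c k)"
          using fh by (intro add_mono ereal_mult_left_mono) (auto simp: S_def)
        finally have "total_variation (\<lambda>x. (f x + h x) / 2) \<le> ereal (c k)"
          by simp
        moreover have "(\<lambda>x. (f x + h x) / 2) \<in> admissible \<Omega> t"
          unfolding mid
          using admissible_convex_combination[of f \<Omega> t h t "1 / 2" "1 / 2"] fh
          by (simp add: S_def)
        ultimately show ?thesis
          by (simp add: S_def)
      qed
    qed blast
    then obtain g f where g: "\<And>k. g k \<in> S k" and f: "f \<in> borel_measurable lebesgue"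
      and lim: "AE x in lebesgue. (\<lambda>k. g k x) \<longlonglongrightarrow> f x"
      by blast
    have g_adm: "g k \<in> admissible \<Omega> t" for k
      using g by (simp add: S_def)
    have "c \<longlonglongrightarrow> r + 0"
      unfolding c_def using LIMSEQ_inverse_real_of_nat
      by (intro tendsto_add tendsto_const) (simp add: inverse_eq_divide)
    then have "total_variation f \<le> ereal r"
      using f lim g g_adm abs_bound[OF g_adm] \<Omega>
      by (intro total_variation_le_dominated_limit[of f g "indicat_real \<Omega>" c])
        (auto simp: S_def admissible_def fmeasurable_def)
    moreover have "f \<in> admissible \<Omega> t"
      using \<Omega> g_adm f lim by (rule admissible_AE_limit)
    ultimately show ?thesis
      using m_le real order_trans by blast
  qed
qed

lemma TV_profile_attained:
  assumes "\<Omega> \<in> lmeasurable" "t \<in> {0..measure lebesgue \<Omega>}"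
  obtains f where "f \<in> admissible \<Omega> t" "TV_profile \<Omega> t = total_variation f"
    "\<And>h. h \<in> admissible \<Omega> t \<Longrightarrow> TV_profile \<Omega> t \<le> total_variation h"
proof -
  obtain f where f: "f \<in> admissible \<Omega> t"
    and min: "\<And>h. h \<in> admissible \<Omega> t \<Longrightarrow> total_variation f \<le> total_variation h"
    using total_variation_attains_min[OF assms(1) admissible_nonempty[OF assms]] by blast
  have "TV_profile \<Omega> t = total_variation f"
    unfolding TV_profile_def using f min by (intro Least_equality) auto
  with f min that show ?thesis by simp
qed

section \<open>Convexity of the profile\<close>

theorem proposition3p4:
  fixes \<Omega> :: "(real ^ 'n) set"
  assumes "compact \<Omega>"
  shows "(\<forall>t\<in>{0..measure lebesgue \<Omega>}. 0 \<le> TV_profile \<Omega> t) \<and>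
         ereal_convex_on {0..measure lebesgue \<Omega>} (TV_profile \<Omega>)"
proof (intro conjI ballI)
  have \<Omega>: "\<Omega> \<in> lmeasurable"
    using assms by (rule lmeasurable_compact)
  show "0 \<le> TV_profile \<Omega> t" if "t \<in> {0..measure lebesgue \<Omega>}" for t
    using TV_profile_attained[OF \<Omega> that] total_variation_nonneg by metis
  show "ereal_convex_on {0..measure lebesgue \<Omega>} (TV_profile \<Omega>)"
    unfolding ereal_convex_on_def
  proof (intro conjI ballI allI impI)
    show conv: "convex {0..measure lebesgue \<Omega>}" by simp
    fix s t u v :: real
    assume st: "s \<in> {0..measure lebesgue \<Omega>}" "t \<in> {0..measure lebesgue \<Omega>}"
      and uv: "0 \<le> u" "0 \<le> v" "u + v = 1"
    obtain f where f: "f \<in> admissible \<Omega> s" "TV_profile \<Omega> s = total_variation f"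
      using TV_profile_attained[OF \<Omega> st(1)] by blast
    obtain g where g: "g \<in> admissible \<Omega> t" "TV_profile \<Omega> t = total_variation g"
      using TV_profile_attained[OF \<Omega> st(2)] by blast
    have "u *\<^sub>R s + v *\<^sub>R t \<in> {0..measure lebesgue \<Omega>}"
      using convexD[OF conv st uv] .
    then have "TV_profile \<Omega> (u *\<^sub>R s + v *\<^sub>R t) \<le> total_variation (\<lambda>x. u * f x + v * g x)"
      using TV_profile_attained[OF \<Omega>] admissible_convex_combination[OF f(1) g(1) uv]
      by (metis real_scaleR_def)
    also have "\<dots> \<le> ereal u * total_variation f + ereal v * total_variation g"
      using f(1) g(1) uv by (intro total_variation_convex_combination) (auto simp: admissible_def)
    finally show "TV_profile \<Omega> (u *\<^sub>R s + v *\<^sub>R t) \<le>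
        ereal u * TV_profile \<Omega> s + ereal v * TV_profile \<Omega> t"
      by (simp add: f(2) g(2))
  qed
qed

end
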